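(* Any deterministic algorithm for the $k$-median problem that runs in $\tilde O(nk)$ time when given a metric space of size $n$ has an approximation ratio of $\Omega\!\left(\frac{\log n}{\log k+\log\log n}\right)$.
   Context: Given a finite metric space $(V,d)$ of size $n$ (with unit weights) and an integer $k$, the $k$-median problem asks for $S\subseteq V$, $|S|\le k$, minimizing $\mathrm{cost}(S)=\sum_{x\in V}d(x,S)$, where $d(x,S)=\min_{y\in S}d(x,y)$. An algorithm accesses the metric only by querying distances $d(x,y)$ between points of $V$ (each query costs at least one unit of time). Its approximation ratio is the worst-case ratio between the cost of its output and the optimal cost. $\tilde O(\cdot)$ hides polylogarithmic factors. *)

theory Defs
  imports "HOL-Analysis.Analysis"
begin

text \<open>
  An instance of size \<open>n\<close> has the point set \<open>{..<n}\<close>; its metric is a function \<open>d\<close> with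
  \<^term>\<open>Metric_space {..<n} d\<close>.
\<close>

definition dist_to_set :: "(nat \<Rightarrow> nat \<Rightarrow> real) \<Rightarrow> nat \<Rightarrow> nat set \<Rightarrow> real" where
  "dist_to_set d x S = Min (d x ` S)"

definition cost :: "nat \<Rightarrow> (nat \<Rightarrow> nat \<Rightarrow> real) \<Rightarrow> nat set \<Rightarrow> real" where
  "cost n d S = (\<Sum>x<n. dist_to_set d x S)"

text \<open>Solutions are nonempty, since \<open>d(x, S)\<close> is a minimum over \<open>S\<close>.\<close>

definition solutions :: "nat \<Rightarrow> nat \<Rightarrow> nat set set" where
  "solutions n k = {S. S \<subseteq> {..<n} \<and> S \<noteq> {} \<and> card S \<le> k}"

definition opt_cost :: "nat \<Rightarrow> nat \<Rightarrow> (nat \<Rightarrow> nat \<Rightarrow> real) \<Rightarrow> real" where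
  "opt_cost n k d = Min (cost n d ` solutions n k)"

text \<open>
  Deterministic computations with oracle access to a metric. \<open>Query x y f\<close> asks for the distance
  between \<open>x\<close> and \<open>y\<close> and continues with \<open>f r\<close> on the answer \<open>r\<close>; \<open>Compute\<close> is one unit of internal
  computation. The behaviour may depend arbitrarily on all answers received so far, and no
  uniformity in the size of the instance is imposed, so every deterministic algorithm in a model
  where a query takes at least one unit of time is covered.
\<close>

datatype computation =
    Return "nat set"
  | Compute computation
  | Query nat nat "real \<Rightarrow> computation"

primrec result :: "(nat \<Rightarrow> nat \<Rightarrow> real) \<Rightarrow> computation \<Rightarrow> nat set" where
  "result d (Return S) = S"
| "result d (Compute c) = result d c"
| "result d (Query x y f) = result d (f (d x y))"

primrec queries :: "(nat \<Rightarrow> nat \<Rightarrow> real) \<Rightarrow> computation \<Rightarrow> (nat \<times> nat) list" where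
  "queries d (Return S) = []"
| "queries d (Compute c) = queries d c"
| "queries d (Query x y f) = (x, y) # queries d (f (d x y))"

primrec running_time :: "(nat \<Rightarrow> nat \<Rightarrow> real) \<Rightarrow> computation \<Rightarrow> nat" where
  "running_time d (Return S) = 0"
| "running_time d (Compute c) = Suc (running_time d c)"
| "running_time d (Query x y f) = Suc (running_time d (f (d x y)))"

text \<open>An algorithm receives \<open>n\<close> and \<open>k\<close> as input and the metric as an oracle.\<close>

type_synonym algorithm = "nat \<Rightarrow> nat \<Rightarrow> computation"

definition k_median_algorithm :: "algorithm \<Rightarrow> bool" where
  "k_median_algorithm A \<longleftrightarrow>
    (\<forall>n\<ge>1. \<forall>k\<ge>1. \<forall>d. Metric_space {..<n} d \<longrightarrow>
      set (queries d (A n k)) \<subseteq> {..<n} \<times> {..<n} \<and> result d (A n k) \<in> solutions n k)"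

text \<open>
  Running time \<open>O(n k polylog(n k))\<close> as \<open>n\<close> tends to infinity, uniformly in \<open>k\<close> and in the metric.
\<close>

definition runs_in_soft_O_nk :: "algorithm \<Rightarrow> bool" where
  "runs_in_soft_O_nk A \<longleftrightarrow>
    (\<exists>C::real. \<exists>p::nat. \<forall>\<^sub>F n in sequentially. \<forall>k\<ge>1. \<forall>d. Metric_space {..<n} d \<longrightarrow>
      real (running_time d (A n k)) \<le> C * (real n * real k) * ln (real n * real k) ^ p)"

text \<open>
  The ratio of a solution's cost to the optimal cost. The optimal cost vanishes iff \<open>k \<ge> n\<close>;
  an optimal solution then has ratio 1 and any other solution has ratio \<open>\<infinity>\<close>.
\<close>

definition cost_ratio :: "real \<Rightarrow> real \<Rightarrow> ereal" where
  "cost_ratio c opt =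
    (if opt = 0 then (if c = 0 then 1 else \<infinity>) else ereal (c / opt))"

definition approx_ratio :: "algorithm \<Rightarrow> nat \<Rightarrow> nat \<Rightarrow> ereal" where
  "approx_ratio A n k =
    (SUP d\<in>{d. Metric_space {..<n} d}.
      cost_ratio (cost n d (result d (A n k))) (opt_cost n k d))"

end

theory Submission
  imports Defs
begin

text \<open>
  An adversary answers the queries. It maintains a set \<open>E\<close> of committed unit edges; a vertex is
  closed once it has \<open>D\<close> of them. The answer to a query is the hop distance, capped at \<open>H\<close>, in the
  optimistic graph where all open vertices are adjacent to each other. Since at most one edge between
  open vertices is needed on a shortest path, one new committed edge per query makes the answer
  permanent, although the optimistic graph shrinks later. With \<open>T\<close> queries at most \<open>2 T / D\<close> vertices
  become closed. When the algorithm has returned \<open>S\<close>, the adversary also closes the ball of radius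
  \<open>H\<close> around \<open>S\<close> with respect to \<open>E\<close>, which has at most \<open>k D\<^sup>H\<close> points because the degrees in \<open>E\<close> are
  at most \<open>D\<close>. All other points then are at distance \<open>H\<close> from \<open>S\<close>, whereas some open vertex is within
  distance 1 of all but \<open>O(n / H)\<close> points, so that the ratio is of order \<open>H\<close>. This works with
  \<open>D \<approx> k (ln n)\<^bsup>p + 2\<^esup>\<close> and \<open>H\<close> of order \<open>ln n / ln D\<close>.
\<close>

section \<open>Hop distance truncated at \<open>H\<close>\<close>

text \<open>The disjunct \<open>i = H\<close> is both the cap and the value for disconnected pairs,
  so that \<open>LEAST\<close> always has a candidate.\<close>

definition capped_hops :: "nat \<Rightarrow> 'a rel \<Rightarrow> 'a \<Rightarrow> 'a \<Rightarrow> nat" where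
  "capped_hops H R x y = (LEAST i. i = H \<or> (x, y) \<in> R ^^ i)"

abbreviation hop_metric :: "nat \<Rightarrow> 'a rel \<Rightarrow> 'a \<Rightarrow> 'a \<Rightarrow> real" where
  "hop_metric H R x y \<equiv> real (capped_hops H R x y)"

lemma capped_hops_le_iff:
  "capped_hops H R x y \<le> i \<longleftrightarrow> H \<le> i \<or> (\<exists>j\<le>i. (x, y) \<in> R ^^ j)"
proof
  assume "capped_hops H R x y \<le> i"
  moreover have "capped_hops H R x y = H \<or> (x, y) \<in> R ^^ capped_hops H R x y"
    unfolding capped_hops_def by (rule LeastI[of _ H]) simp
  ultimately show "H \<le> i \<or> (\<exists>j\<le>i. (x, y) \<in> R ^^ j)" by metis
next
  assume "H \<le> i \<or> (\<exists>j\<le>i. (x, y) \<in> R ^^ j)"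
  then obtain j where "j \<le> i" "j = H \<or> (x, y) \<in> R ^^ j" by blast
  then show "capped_hops H R x y \<le> i"
    unfolding capped_hops_def
    using Least_le[of "\<lambda>i. i = H \<or> (x, y) \<in> R ^^ i" j] by simp
qed

lemma capped_hops_leI: "(x, y) \<in> R ^^ j \<Longrightarrow> j \<le> i \<Longrightarrow> capped_hops H R x y \<le> i"
  unfolding capped_hops_le_iff by blast

lemma capped_hops_le: "capped_hops H R x y \<le> H"
  by (simp add: capped_hops_le_iff)

lemma capped_hops_cases:
  obtains "capped_hops H R x y = H" | "(x, y) \<in> R ^^ capped_hops H R x y"
proof -
  have "capped_hops H R x y = H \<or> (x, y) \<in> R ^^ capped_hops H R x y"
    unfolding capped_hops_def by (rule LeastI[of _ H]) simp
  then show thesis using that by blast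
qed

lemma relpow_subset:
  fixes R S :: "'a rel"
  assumes "R \<subseteq> S"
  shows "R ^^ i \<subseteq> S ^^ i"
  by (induction i) (use assms in auto)

lemma capped_hops_antimono:
  assumes "R \<subseteq> S"
  shows "capped_hops H S x y \<le> capped_hops H R x y"
proof (cases rule: capped_hops_cases[of H R x y])
  case 1
  then show ?thesis by (simp add: capped_hops_le)
next
  case 2
  then show ?thesis using relpow_subset[OF assms] by (intro capped_hops_leI) auto
qed

lemma relpow_trans: "(x, y) \<in> R ^^ i \<Longrightarrow> (y, z) \<in> R ^^ j \<Longrightarrow> (x, z) \<in> R ^^ (i + j)"
  by (auto simp: relpow_add)

lemma sym_relpow:
  fixes R :: "'a rel"
  assumes "sym R"
  shows "sym (R ^^ i)"
proof (rule symI)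
  show "(y, x) \<in> R ^^ i" if "(x, y) \<in> R ^^ i" for x y
    using that
  proof (induction i arbitrary: y)
    case (Suc i)
    then obtain w where w: "(x, w) \<in> R ^^ i" "(w, y) \<in> R" by auto
    then have "(y, w) \<in> R" "(w, x) \<in> R ^^ i" using Suc.IH assms by (auto dest: symD)
    then show ?case by (rule relpow_Suc_I2)
  qed simp
qed

text \<open>For the triangle inequality, either one summet on the right is already \<open>H\<close>,
  the maximum of the left side, or two walks can be concatenated. Positivity of \<open>H\<close>
  separates distinct points.\<close>

lemma Metric_space_hop_metric:
  assumes "sym R" "H > 0"
  shows "Metric_space M (hop_metric H R)"
proof
  fix x y z
  show "hop_metric H R x y = hop_metric H R y x"
    using sym_relpow[OF assms(1)] unfolding capped_hops_def by (metis symD)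
  show "(hop_metric H R x y = 0) = (x = y)"
    using capped_hops_le_iff[of H R x y 0] assms(2) by simp
  have "capped_hops H R x z \<le> capped_hops H R x y + capped_hops H R y z"
  proof (cases rule: capped_hops_cases[of H R x y])
    case 1
    then show ?thesis using capped_hops_le[of H R x z] by linarith
  next
    case xy: 2
    show ?thesis
    proof (cases rule: capped_hops_cases[of H R y z])
      case 1
      then show ?thesis using capped_hops_le[of H R x z] by linarith
    next
      case 2
      with xy have "(x, z) \<in> R ^^ (capped_hops H R x y + capped_hops H R y z)"
        by (intro relpow_trans)
      then show ?thesis by (rule capped_hops_leI) simp
    qed
  qed
  then show "hop_metric H R x z \<le> hop_metric H R x y + hop_metric H R y z" by linarith
qed simp

section \<open>Committed edges and the adversary\<close>

definition closed_vertices :: "nat \<Rightarrow> 'a rel \<Rightarrow> 'a set" where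
  "closed_vertices D E = {x. D \<le> card (E `` {x})}"

definition add_clique :: "'a rel \<Rightarrow> 'a set \<Rightarrow> 'a rel" where
  "add_clique E U = E \<union> U \<times> U"

definition valid_edges :: "nat \<Rightarrow> 'a set \<Rightarrow> 'a rel \<Rightarrow> bool" where
  "valid_edges D V E \<longleftrightarrow> E \<subseteq> V \<times> V \<and> sym E \<and> (\<forall>x. card (E `` {x}) \<le> D)"

abbreviation optimistic :: "nat \<Rightarrow> 'a set \<Rightarrow> 'a rel \<Rightarrow> 'a rel" where
  "optimistic D V E \<equiv> add_clique E (V - closed_vertices D E)"

text \<open>The part of a walk between its first and last vertex in \<open>U\<close> can be replaced by one edge.\<close>

lemma add_clique_relpow:
  assumes "(x, y) \<in> add_clique E U ^^ i"
  shows "(x, y) \<in> E ^^ i \<or>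
    (\<exists>a\<in>U. \<exists>b\<in>U. \<exists>j l. (x, a) \<in> E ^^ j \<and> (b, y) \<in> E ^^ l \<and> j + 1 + l \<le> i)"
  using assms
proof (induction i arbitrary: y)
  case 0
  then show ?case by simp
next
  case (Suc i)
  then obtain w where xw: "(x, w) \<in> add_clique E U ^^ i" and wy: "(w, y) \<in> add_clique E U"
    by auto
  have wy': "(w, y) \<in> E \<or> w \<in> U \<and> y \<in> U" using wy by (auto simp: add_clique_def)
  from Suc.IH[OF xw] show ?case
  proof (elim disjE bexE exE conjE)
    assume "(x, w) \<in> E ^^ i"
    with wy' show ?thesis
      by (metis Suc_eq_plus1 add.right_neutral order_refl relpow_0_I relpow_Suc_I)
  next
    fix a b j l
    assume a: "a \<in> U" "b \<in> U" "(x, a) \<in> E ^^ j" "(b, w) \<in> E ^^ l" "j + 1 + l \<le> i"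
    from wy' show ?thesis
    proof
      assume "(w, y) \<in> E"
      then have "(b, y) \<in> E ^^ Suc l" using a by auto
      moreover have "j + 1 + Suc l \<le> Suc i" using a by simp
      ultimately show ?thesis using a by blast
    next
      assume "w \<in> U \<and> y \<in> U"
      moreover have "(y, y) \<in> E ^^ 0" "j + 1 + 0 \<le> Suc i" using a by auto
      ultimately show ?thesis using a by blast
    qed
  qed
qed

text \<open>An open end has degree below \<open>D\<close>, so one more edge respects the degree
  bound. The new edge already belongs to the optimistic graph, and vertices that become closed only
  remove clique edges. The case \<open>a = b\<close> adds a loop.\<close>

lemma commit_edge:
  assumes E: "valid_edges D V E" and fin: "finite V"
    and a: "a \<in> V - closed_vertices D E" and b: "b \<in> V - closed_vertices D E"
  defines "E' \<equiv> E \<union> {(a, b), (b, a)}"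
  shows "valid_edges D V E'" "card E' \<le> card E + 2"
    "optimistic D V E' \<subseteq> optimistic D V E"
proof -
  have fin_im: "finite (F `` {x})" if "F \<subseteq> V \<times> V" for F x
    by (rule finite_subset[of _ V]) (use that fin in auto)
  have sub: "E' \<subseteq> V \<times> V" using E a b by (auto simp: E'_def valid_edges_def)
  have deg: "card (E' `` {x}) \<le> D" for x
  proof -
    consider "x = a" | "x = b" | "x \<noteq> a" "x \<noteq> b" by blast
    then show ?thesis
    proof cases
      case 1
      have "E' `` {x} \<subseteq> insert b (E `` {x})" using 1 by (auto simp: E'_def)
      moreover have "card (insert b (E `` {x})) \<le> D"
        using a 1 fin_im[of E x] E
        by (auto simp: closed_vertices_def valid_edges_def card_insert_if)
      ultimately show ?thesis
        by (metis card_mono E fin_im finite_insert le_trans valid_edges_def)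
    next
      case 2
      have "E' `` {x} \<subseteq> insert a (E `` {x})" using 2 by (auto simp: E'_def)
      moreover have "card (insert a (E `` {x})) \<le> D"
        using b 2 fin_im[of E x] E
        by (auto simp: closed_vertices_def valid_edges_def card_insert_if)
      ultimately show ?thesis
        by (metis card_mono E fin_im finite_insert le_trans valid_edges_def)
    next
      case 3
      then have "E' `` {x} = E `` {x}" by (auto simp: E'_def)
      then show ?thesis using E by (simp add: valid_edges_def)
    qed
  qed
  have "sym E'" using E by (auto simp: E'_def valid_edges_def sym_def)
  then show "valid_edges D V E'" using sub deg by (simp add: valid_edges_def)
  show "card E' \<le> card E + 2"
    using card_Un_le[of E "{(a, b), (b, a)}"] card_insert_le_m1[of 2 "{(b, a)}" "(a, b)"]
    by (simp add: E'_def)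
  have "closed_vertices D E \<subseteq> closed_vertices D E'"
  proof
    fix x assume "x \<in> closed_vertices D E"
    moreover have "card (E `` {x}) \<le> card (E' `` {x})"
      by (rule card_mono[OF fin_im[OF sub]]) (auto simp: E'_def)
    ultimately show "x \<in> closed_vertices D E'" by (simp add: closed_vertices_def)
  qed
  then show "optimistic D V E' \<subseteq> optimistic D V E"
    using a b by (auto simp: E'_def add_clique_def)
qed

text \<open>An answer \<open>H\<close>, or one attained by a walk in \<open>E\<close>, needs no
  commitment. Otherwise one edge between open vertices suffices. The last inequality makes
  \<open>E'\<close> and the old optimistic graph agree on the pair, and hence all graphs between
  them.\<close>

lemma commit_query:
  assumes E: "valid_edges D V E" and fin: "finite V"
  obtains E' where "E \<subseteq> E'" "valid_edges D V E'" "card E' \<le> card E + 2"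
    "optimistic D V E' \<subseteq> optimistic D V E"
    "capped_hops H E' x y \<le> capped_hops H (optimistic D V E) x y"
proof (cases rule: capped_hops_cases[of H "optimistic D V E" x y])
  case 1
  then show ?thesis using that[of E] E capped_hops_le[of H E x y] by simp
next
  case 2
  let ?v = "capped_hops H (optimistic D V E) x y"
  from add_clique_relpow[OF 2] show ?thesis
  proof (elim disjE bexE exE conjE)
    assume "(x, y) \<in> E ^^ ?v"
    then have "capped_hops H E x y \<le> ?v" by (rule capped_hops_leI) simp
    then show ?thesis using that[of E] E by simp
  next
    fix a b j l
    assume ab: "a \<in> V - closed_vertices D E" "b \<in> V - closed_vertices D E"
      and j: "(x, a) \<in> E ^^ j" and l: "(b, y) \<in> E ^^ l" and jl: "j + 1 + l \<le> ?v"
    let ?E = "E \<union> {(a, b), (b, a)}"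
    have "(x, a) \<in> ?E ^^ j" "(b, y) \<in> ?E ^^ l"
      using j l relpow_subset[of E ?E] by blast+
    moreover have "(a, b) \<in> ?E ^^ 1" by simp
    ultimately have "(x, y) \<in> ?E ^^ (j + 1 + l)"
      by (blast intro: relpow_trans)
    then have "capped_hops H ?E x y \<le> ?v"
      using jl by (rule capped_hops_leI)
    then show ?thesis
      using that[of ?E] commit_edge[OF E fin ab] by blast
  qed
qed

text \<open>
  The output is the same for all graphs that the adversary can still choose; this is what allows
  it to pick the final graph depending on the output.
\<close>

definition forces :: "nat \<Rightarrow> nat \<Rightarrow> nat set \<Rightarrow> nat rel \<Rightarrow> computation \<Rightarrow> nat \<Rightarrow> nat set \<Rightarrow> bool" where
  "forces H D V E c m S \<longleftrightarrow> (\<forall>G. E \<subseteq> G \<longrightarrow> G \<subseteq> optimistic D V E \<longrightarrow>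
    result (hop_metric H G) c = S \<and> card E \<le> m + 2 * running_time (hop_metric H G) c)"

text \<open>Induction on the computation, for all edge sets at once: after a query the continuation
  for the optimistic answer is treated starting from the enlarged edge set. The factor 2 in
  \<open>forces\<close> counts both orientations of a committed edge.\<close>

lemma adversary:
  assumes "finite V" "valid_edges D V E"
  shows "\<exists>E' S. E \<subseteq> E' \<and> valid_edges D V E' \<and> optimistic D V E' \<subseteq> optimistic D V E \<and>
    forces H D V E' c (card E) S"
  using assms(2)
proof (induction c arbitrary: E)
  case (Return S)
  then show ?case by (intro exI[of _ E] exI[of _ S]) (simp add: forces_def)
next
  case (Compute c)
  obtain E' S where E': "E \<subseteq> E'" "valid_edges D V E'"
    "optimistic D V E' \<subseteq> optimistic D V E" "forces H D V E' c (card E) S"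
    using Compute.IH[OF Compute.prems] by blast
  have "forces H D V E' (Compute c) (card E) S"
    unfolding forces_def
  proof (intro allI impI)
    fix G assume "E' \<subseteq> G" "G \<subseteq> optimistic D V E'"
    with E'(4) have "result (hop_metric H G) c = S \<and>
        card E' \<le> card E + 2 * running_time (hop_metric H G) c"
      unfolding forces_def by blast
    then show "result (hop_metric H G) (Compute c) = S \<and>
        card E' \<le> card E + 2 * running_time (hop_metric H G) (Compute c)" by simp
  qed
  then show ?case using E' by blast
next
  case (Query x y f)
  let ?v = "hop_metric H (optimistic D V E) x y"
  obtain E1 where E1: "E \<subseteq> E1" "valid_edges D V E1" "card E1 \<le> card E + 2"
    "optimistic D V E1 \<subseteq> optimistic D V E"
    "capped_hops H E1 x y \<le> capped_hops H (optimistic D V E) x y"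
    using commit_query[OF Query.prems assms(1)] .
  obtain E' S where E': "E1 \<subseteq> E'" "valid_edges D V E'"
    "optimistic D V E' \<subseteq> optimistic D V E1" "forces H D V E' (f ?v) (card E1) S"
    using Query.IH[OF rangeI E1(2), of ?v] by blast
  have "forces H D V E' (Query x y f) (card E) S"
    unfolding forces_def
  proof (intro allI impI)
    fix G assume G: "E' \<subseteq> G" "G \<subseteq> optimistic D V E'"
    with E'(4) have sim: "result (hop_metric H G) (f ?v) = S \<and>
        card E' \<le> card E1 + 2 * running_time (hop_metric H G) (f ?v)"
      unfolding forces_def by blast
    have "E1 \<subseteq> G" "G \<subseteq> optimistic D V E" using G E' E1 by blast+
    \<comment> \<open>\<open>G\<close> lies between \<open>E1\<close> and the optimistic graph of
      \<open>E\<close>, so antitonicity bounds its answer from both sides by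
      \<open>?v\<close>.\<close>
    then have answer: "hop_metric H G x y = ?v"
      using capped_hops_antimono[of E1 G H x y]
        capped_hops_antimono[of G "optimistic D V E" H x y] E1(5) by linarith
    show "result (hop_metric H G) (Query x y f) = S \<and>
        card E' \<le> card E + 2 * running_time (hop_metric H G) (Query x y f)"
      using sim E1(3) by (simp add: answer)
  qed
  then show ?case using E' E1 by blast
qed

section \<open>Balls and closed vertices: counting\<close>

definition hop_ball :: "nat \<Rightarrow> 'a rel \<Rightarrow> 'a set \<Rightarrow> 'a set" where
  "hop_ball m E S = (\<Union>i<m. (E ^^ i) `` S)"

lemma relpow_Image_subset:
  assumes "E \<subseteq> V \<times> V" "S \<subseteq> V"
  shows "(E ^^ i) `` S \<subseteq> V"
  using assms by (induction i) (auto simp: Image_iff)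

lemma card_relpow_Image_le:
  assumes "valid_edges D V E" "finite V" "S \<subseteq> V"
  shows "card ((E ^^ i) `` S) \<le> card S * D ^ i"
proof (induction i)
  case 0
  then show ?case by simp
next
  case (Suc i)
  let ?T = "(E ^^ i) `` S"
  have fin: "finite ?T"
    using relpow_Image_subset[of E V S i] assms finite_subset by (metis valid_edges_def)
  have "(E ^^ Suc i) `` S = (\<Union>x\<in>?T. E `` {x})" by auto
  also have "card \<dots> \<le> (\<Sum>x\<in>?T. card (E `` {x}))" by (rule card_UN_le[OF fin])
  also have "\<dots> \<le> card ?T * D"
    using assms(1) sum_bounded_above[of ?T "\<lambda>x. card (E `` {x})" D]
    by (simp add: valid_edges_def)
  also have "\<dots> \<le> card S * D ^ i * D" using Suc by (rule mult_le_mono1)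
  finally show ?case by (simp add: mult_ac)
qed

lemma card_hop_ball_le:
  assumes "valid_edges D V E" "finite V" "S \<subseteq> V" "D \<ge> 2"
  shows "card (hop_ball m E S) \<le> card S * D ^ m"
proof (induction m)
  case 0
  then show ?case by (simp add: hop_ball_def)
next
  case (Suc m)
  have "hop_ball (Suc m) E S = hop_ball m E S \<union> (E ^^ m) `` S"
    by (simp add: hop_ball_def lessThan_Suc Un_commute)
  then have "card (hop_ball (Suc m) E S) \<le> card (hop_ball m E S) + card ((E ^^ m) `` S)"
    by (simp add: card_Un_le)
  also have "\<dots> \<le> card S * D ^ m + card S * D ^ m"
    using Suc card_relpow_Image_le[OF assms(1-3)] by (rule add_mono)
  \<comment> \<open>The hypothesis \<open>D \<ge> 2\<close> absorbs the doubling, which avoids a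
    geometric sum.\<close>
  also have "\<dots> = card S * D ^ m * 2" by simp
  also have "\<dots> \<le> card S * D ^ m * D" using assms(4) by (rule mult_le_mono2)
  finally show ?case by (simp add: mult_ac)
qed

lemma card_closed_vertices_le:
  assumes "E \<subseteq> V \<times> V" "finite V"
  shows "card (V \<inter> closed_vertices D E) * D \<le> card E"
proof -
  have "card (V \<inter> closed_vertices D E) * D \<le> (\<Sum>x\<in>V \<inter> closed_vertices D E. card (E `` {x}))"
    using sum_bounded_below[of "V \<inter> closed_vertices D E" D "\<lambda>x. card (E `` {x})"]
    by (simp add: closed_vertices_def)
  also have "\<dots> \<le> (\<Sum>x\<in>V. card (E `` {x}))"
    by (rule sum_mono2) (use assms in auto)
  also have "\<dots> = card (SIGMA x:V. E `` {x})"
    using assms by (subst card_SigmaI) (auto intro: finite_subset[of _ V])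
  also have "(SIGMA x:V. E `` {x}) = E" using assms by auto
  finally show ?thesis .
qed

text \<open>A walk from \<open>s\<close> with fewer than \<open>H\<close> steps takes each step from
  a vertex of the ball. As \<open>U\<close> avoids the ball, no such step is a clique edge, so the
  walk lies in \<open>E\<close> and ends in the ball.\<close>

lemma capped_hops_outside_ball:
  assumes "s \<in> S" "y \<notin> hop_ball H E S" "U \<inter> hop_ball H E S = {}"
  shows "capped_hops H (add_clique E U) s y = H"
proof (rule ccontr)
  assume neq: "capped_hops H (add_clique E U) s y \<noteq> H"
  have inball: "(s, z) \<in> E ^^ i" if "(s, z) \<in> add_clique E U ^^ i" "i < H" for z i
    using that
  proof (induction i arbitrary: z)
    case 0
    then show ?case by simp
  next
    case (Suc i)
    then obtain w where w: "(s, w) \<in> add_clique E U ^^ i" "(w, z) \<in> add_clique E U" by auto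
    then have sw: "(s, w) \<in> E ^^ i" using Suc by simp
    then have "w \<in> hop_ball H E S" using assms(1) Suc.prems by (auto simp: hop_ball_def)
    then have "(w, z) \<in> E" using w(2) assms(3) by (auto simp: add_clique_def)
    then show ?case using sw by auto
  qed
  show False
  proof (cases rule: capped_hops_cases[of H "add_clique E U" s y])
    case 1
    then show ?thesis using neq by simp
  next
    case 2
    let ?i = "capped_hops H (add_clique E U) s y"
    have i: "?i < H" using neq capped_hops_le[of H "add_clique E U" s y] by linarith
    from inball[OF 2 i] have "y \<in> (E ^^ ?i) `` S" using assms(1) by auto
    then show False using assms(2) i unfolding hop_ball_def by blast
  qed
qed

section \<open>Costs and ratios\<close>

lemma finite_solutions: "finite (solutions n k)"
  by (rule finite_subset[of _ "Pow {..<n}"]) (auto simp: solutions_def)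

lemma opt_cost_le: "S \<in> solutions n k \<Longrightarrow> opt_cost n k d \<le> cost n d S"
  unfolding opt_cost_def by (rule Min_le) (auto simp: finite_solutions)

lemma cost_nonneg:
  assumes "Metric_space {..<n} d" "S \<in> solutions n k"
  shows "0 \<le> cost n d S"
proof -
  have "finite S" "S \<noteq> {}" using assms(2) finite_subset by (auto simp: solutions_def)
  then show ?thesis
    unfolding cost_def dist_to_set_def
    by (intro sum_nonneg) (auto simp: Metric_space.nonneg[OF assms(1)])
qed

lemma opt_cost_nonneg:
  assumes "Metric_space {..<n} d" "S \<in> solutions n k"
  shows "0 \<le> opt_cost n k d"
  unfolding opt_cost_def
  using assms finite_solutions[of n k] cost_nonneg[OF assms(1)] by (subst Min_ge_iff) auto

text \<open>Positivity of \<open>c\<close> makes the ratio infinite when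
  \<open>opt = 0\<close>.\<close>

lemma cost_ratio_ge:
  assumes "0 \<le> opt" "opt \<le> b" "r * b \<le> c" "0 \<le> r" "0 < c"
  shows "ereal r \<le> cost_ratio c opt"
proof (cases "opt = 0")
  case True
  then show ?thesis using assms by (simp add: cost_ratio_def)
next
  case False
  have "r * opt \<le> r * b" using assms by (simp add: mult_left_mono)
  then show ?thesis using False assms by (simp add: cost_ratio_def pos_le_divide_eq)
qed

lemma cost_ratio_le_approx_ratio:
  assumes "Metric_space {..<n} d"
  shows "cost_ratio (cost n d (result d (A n k))) (opt_cost n k d) \<le> approx_ratio A n k"
  unfolding approx_ratio_def by (rule SUP_upper) (use assms in simp)

text \<open>One metric suffices as a witness; the discrete one is the hop metric of the empty graph
  with cap 1.\<close>

lemma approx_ratio_ge_1: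
  assumes "k_median_algorithm A" "n \<ge> 1" "k \<ge> 1"
  shows "1 \<le> approx_ratio A n k"
proof -
  let ?d = "hop_metric 1 {} :: nat \<Rightarrow> nat \<Rightarrow> real"
  have m: "Metric_space {..<n} ?d" by (rule Metric_space_hop_metric) (auto simp: sym_def)
  have S: "result ?d (A n k) \<in> solutions n k"
    using assms m by (simp add: k_median_algorithm_def)
  have "1 \<le> cost_ratio (cost n ?d (result ?d (A n k))) (opt_cost n k ?d)"
    using opt_cost_nonneg[OF m S] opt_cost_le[OF S, of ?d] by (auto simp: cost_ratio_def)
  then show ?thesis using cost_ratio_le_approx_ratio[OF m] order_trans by blast
qed

section \<open>The lower bound for fixed parameters\<close>

text \<open>\<open>TH\<close> leaves at most \<open>n / (2 * H)\<close> closed vertices and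
  \<open>kD\<close> at most \<open>n / (4 * H)\<close> points in the ball. Hence a center in
  \<open>U\<close> costs at most \<open>3 * n / 4 + n \<le> 2 * n\<close>, while the output costs at
  least \<open>H * n / 2\<close>.\<close>

lemma approx_ratio_ge:
  fixes T :: real
  assumes A: "k_median_algorithm A" and n: "n \<ge> 1" and k: "k \<ge> 1"
    and T: "\<And>d. Metric_space {..<n} d \<Longrightarrow> real (running_time d (A n k)) \<le> T"
    and D: "D \<ge> 2" and H: "H \<ge> 1"
    and TH: "4 * T * real H \<le> real D * real n"
    and kD: "4 * H * k * D ^ H \<le> n"
  shows "ereal (real H / 4) \<le> approx_ratio A n k"
proof -
  let ?V = "{..<n}"
  have "valid_edges D ?V {}" by (simp add: valid_edges_def sym_def)
  from adversary[OF _ this, of H "A n k"] obtain E S where E: "valid_edges D ?V E"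
    and sim: "forces H D ?V E (A n k) 0 S"
    by auto
  define B where "B = hop_ball H E S"
  define U where "U = ?V - closed_vertices D E - B"
  \<comment> \<open>\<open>B\<close> depends on the output \<open>S\<close>, but \<open>G\<close>
    still lies between \<open>E\<close> and the optimistic graph, so \<open>forces\<close>
    guarantees that the output on \<open>G\<close> is \<open>S\<close>.\<close>
  define G where "G = add_clique E U"
  define d where "d = hop_metric H G"
  have G: "E \<subseteq> G" "G \<subseteq> optimistic D ?V E" by (auto simp: G_def U_def add_clique_def)
  have "sym G" using E by (auto simp: G_def add_clique_def valid_edges_def sym_def)
  then have m: "Metric_space ?V d" unfolding d_def using H by (intro Metric_space_hop_metric) auto
  have res: "result d (A n k) = S" and cardE: "card E \<le> 2 * running_time d (A n k)"
    using sim G unfolding forces_def d_def by auto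
  have S: "S \<in> solutions n k" using A m n k res by (metis k_median_algorithm_def)
  then have S': "S \<subseteq> ?V" "S \<noteq> {}" "card S \<le> k" "finite S"
    using finite_subset by (auto simp: solutions_def)
  have EV: "E \<subseteq> ?V \<times> ?V" using E by (simp add: valid_edges_def)
  have BV: "B \<subseteq> ?V" unfolding B_def hop_ball_def
    using relpow_Image_subset[OF EV S'(1)] by blast
  have "H * card B \<le> H * (k * D ^ H)"
    using card_hop_ball_le[OF E _ S'(1) D, of H] S'(3) unfolding B_def
    by (meson finite_lessThan le_trans mult_le_mono1 mult_le_mono2)
  then have HB: "4 * (real H * real (card B)) \<le> real n"
  proof -
    have "4 * (H * card B) \<le> 4 * (H * (k * D ^ H))" by (rule mult_le_mono2) fact
    also have "\<dots> \<le> n" using kD by (simp only: mult.assoc)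
    finally have "real (4 * (H * card B)) \<le> real n" by (simp only: of_nat_le_iff)
    then show ?thesis by simp
  qed
  have Bn: "4 * real (card B) \<le> real n"
  proof -
    have "real (card B) \<le> real H * real (card B)" using H by (simp add: mult_le_cancel_right1)
    then show ?thesis using HB by linarith
  qed
  let ?C = "?V \<inter> closed_vertices D E"
  have HC: "2 * (real H * real (card ?C)) \<le> real n"
  proof -
    have "real (card ?C) * real D \<le> real (card E)"
      using card_closed_vertices_le[OF EV, of D] by (simp flip: of_nat_mult)
    also have "\<dots> \<le> 2 * T" using cardE T[OF m] by linarith
    finally have "(real (card ?C) * real D) * (2 * real H) \<le> (2 * T) * (2 * real H)"
      by (rule mult_right_mono) simp
    then have "real D * (2 * (real H * real (card ?C))) \<le> real D * real n"
      using TH by (simp add: algebra_simps)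
    then show ?thesis using D by (simp add: mult_le_cancel_left)
  qed
  have VU: "?V - U = ?C \<union> B" using BV by (auto simp: U_def)
  have cardVU: "real (card (?V - U)) \<le> real (card ?C) + real (card B)"
    unfolding VU using card_Un_le[of ?C B] by linarith
  have HVU: "4 * (real H * real (card (?V - U))) \<le> 3 * real n"
    using mult_left_mono[OF cardVU, of "real H"] HC HB by (simp add: algebra_simps)
  have "real (card (?V - U)) \<le> real H * real (card (?V - U))"
    using H by (simp add: mult_le_cancel_right1)
  then have "card (?V - U) < card ?V" using HVU n by simp
  then have "U \<noteq> {}" by auto
  then obtain c where c: "c \<in> U" by blast
  have cV: "c < n" using c by (auto simp: U_def)
  have cS: "{c} \<in> solutions n k" using cV k by (simp add: solutions_def)
  have dc: "d x c \<le> (if x \<in> ?V - U then real H else 1)" if "x < n" for x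
  proof (cases "x \<in> U")
    case True
    then have "(x, c) \<in> G ^^ 1" using c by (simp add: G_def add_clique_def)
    then have "capped_hops H G x c \<le> 1" by (rule capped_hops_leI) simp
    then show ?thesis using True by (simp add: d_def)
  next
    case False
    then show ?thesis using that by (simp add: d_def capped_hops_le)
  qed
  have "opt_cost n k d \<le> cost n d {c}" by (rule opt_cost_le[OF cS])
  also have "\<dots> = (\<Sum>x<n. d x c)" by (simp add: cost_def dist_to_set_def)
  also have "\<dots> \<le> (\<Sum>x<n. if x \<in> ?V - U then real H else 1)" by (rule sum_mono) (use dc in simp)
  also have "\<dots> \<le> (\<Sum>x<n. (if x \<in> ?V - U then real H else 0) + 1)" by (rule sum_mono) simp
  also have "\<dots> = real H * real (card (?V - U)) + real n"
  proof -
    have "?V \<inter> (?V - U) = ?V - U" by blast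
    then show ?thesis by (simp only: sum.distrib sum.inter_restrict[OF finite_lessThan, symmetric]) simp
  qed
  finally have opt: "opt_cost n k d \<le> 2 * real n" using HVU by linarith
  have far: "dist_to_set d x S = real H" if "x \<in> ?V - B" for x
  proof -
    have "d x s = real H" if s: "s \<in> S" for s
    proof -
      have "capped_hops H G s x = H" unfolding G_def
        by (rule capped_hops_outside_ball[OF s]) (use \<open>x \<in> ?V - B\<close> in \<open>auto simp: B_def U_def\<close>)
      then show ?thesis using Metric_space.commute[OF m, of x s] by (simp add: d_def)
    qed
    then have "d x ` S = {real H}" using S'(2) by auto
    then show ?thesis by (simp add: dist_to_set_def)
  qed
  have near: "0 \<le> dist_to_set d x S" for x
    unfolding dist_to_set_def using S' by (auto simp: d_def)
  have "real H * real (card (?V - B)) = (\<Sum>x\<in>?V - B. dist_to_set d x S)" using far by simp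
  also have "\<dots> \<le> cost n d S" unfolding cost_def by (rule sum_mono2) (use near in auto)
  finally have "real H * real (card (?V - B)) \<le> cost n d S" .
  moreover have "real (card (?V - B)) = real n - real (card B)"
    using BV card_mono[OF _ BV] by (simp add: card_Diff_subset finite_subset)
  ultimately have "real H * (real n - real (card B)) \<le> cost n d S" by simp
  moreover have "real H * (real n / 2) \<le> real H * (real n - real (card B))"
    using Bn by (intro mult_left_mono) auto
  ultimately have costS: "real H * (real n / 2) \<le> cost n d S" by linarith
  have "0 < real H * (real n / 2)" using H n by simp
  then have pos: "0 < cost n d S" using costS by linarith
  have "ereal (real H / 4) \<le> cost_ratio (cost n d S) (opt_cost n k d)"
    by (rule cost_ratio_ge[OF opt_cost_nonneg[OF m S] opt]) (use costS pos in auto)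
  then show ?thesis using cost_ratio_le_approx_ratio[OF m, of A k]
    unfolding res by (rule order_trans)
qed

section \<open>Choice of the parameters\<close>

lemma eventually_ln_ge: "\<forall>\<^sub>F n in sequentially. (b::real) \<le> ln (real n)"
proof -
  have "LIM n sequentially. ln (real n) :> at_top"
    by (rule filterlim_compose[OF ln_at_top filterlim_real_sequentially])
  then show ?thesis unfolding filterlim_at_top by blast
qed

theorem theorem1p2:
  fixes A :: algorithm
  assumes "k_median_algorithm A"
    and "runs_in_soft_O_nk A"
  shows "\<exists>c::real. c > 0 \<and>
    (\<forall>\<^sub>F n in sequentially. \<forall>k\<ge>1.
      ereal (c * (ln (real n) / (ln (real k) + ln (ln (real n))))) \<le> approx_ratio A n k)"
proof -
  obtain C0 p where run0: "\<forall>\<^sub>F n in sequentially. \<forall>k\<ge>1. \<forall>d. Metric_space {..<n} d \<longrightarrow>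
      real (running_time d (A n k)) \<le> C0 * (real n * real k) * ln (real n * real k) ^ p"
    using assms(2) unfolding runs_in_soft_O_nk_def by blast
  \<comment> \<open>\<open>C0\<close> may be negative; later estimates multiply by the
    constant.\<close>
  define C where "C = max C0 0"
  \<comment> \<open>Chosen so that \<open>H * ln D \<le> y * ((p + 3) * X) = L / 4\<close>.\<close>
  define \<epsilon> where "\<epsilon> = 1 / (4 * (real p + 3))"
  have \<epsilon>: "0 < \<epsilon>" "\<epsilon> \<le> 1 / 4" "\<epsilon> * (real p + 3) = 1 / 4"
    by (auto simp: \<epsilon>_def field_simps)
  \<comment> \<open>The three bounds give \<open>lnL_small\<close>, \<open>1 \<le> ln L\<close>, and
    the absorption of the constant \<open>4 * C * 2 ^ p\<close> into one factor
    \<open>L\<close>.\<close>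
  define b where "b = max (max 40 (exp 1)) (4 * C * 2 ^ p)"
  have "\<forall>\<^sub>F n in sequentially. \<forall>k\<ge>1.
      ereal (\<epsilon> / 8 * (ln (real n) / (ln (real k) + ln (ln (real n))))) \<le> approx_ratio A n k"
    using run0 eventually_ln_ge[of b]
  proof eventually_elim
    case (elim n)
    show ?case
    proof (intro allI impI)
      fix k :: nat assume k: "1 \<le> k"
      define L where "L = ln (real n)"
      define X where "X = ln (real k) + ln L"
      define y where "y = \<epsilon> * (L / X)"
      have L: "40 \<le> L" "exp 1 \<le> L" "4 * C * 2 ^ p \<le> L" using elim(2) by (auto simp: L_def b_def)
      have n1: "n \<ge> 1" using L(1) by (cases n) (auto simp: L_def)
      have lnL: "1 \<le> ln L" using L by (simp add: ln_ge_iff)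
      have lnL_small: "ln 4 + ln L \<le> L / 2"
      proof -
        \<comment> \<open>Rescaling by 8 gives slope 1/8 in \<open>ln x \<le> x - 1\<close>; at
          \<open>L\<close> itself the bound would exceed \<open>L / 2\<close>.\<close>
        have "ln L = ln (L / 8) + ln 8" using L by (simp add: ln_div)
        then show ?thesis
          using ln_le_minus_one[of "L / 8"] ln_le_minus_one[of 4] ln_le_minus_one[of 8] L by simp
      qed
      have lnk: "0 \<le> ln (real k)" using k by simp
      have X1: "1 \<le> X" using lnL lnk by (simp add: X_def)
      have goal_eq: "\<epsilon> / 8 * (ln (real n) / (ln (real k) + ln (ln (real n)))) = y / 8"
        by (simp add: y_def X_def L_def)
      show "ereal (\<epsilon> / 8 * (ln (real n) / (ln (real k) + ln (ln (real n))))) \<le> approx_ratio A n k"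
        unfolding goal_eq
      proof (cases "y \<ge> 1")
        case False \<comment> \<open>covers all \<open>k\<close> exceeding a small power of \<open>n\<close>, in particular \<open>k \<ge> n\<close>\<close>
        then have "ereal (y / 8) \<le> 1" by simp
        then show "ereal (y / 8) \<le> approx_ratio A n k"
          using approx_ratio_ge_1[OF assms(1) n1 k] order_trans by blast
      next
        case True
        define H where "H = nat \<lfloor>y\<rfloor>"
        \<comment> \<open>Of the \<open>p + 2\<close> factors \<open>L\<close>, \<open>p\<close> pay
          for the logarithms in the running time, one for \<open>H \<le> L\<close> and one for the
          constant.\<close>
        define D where "D = nat \<lceil>real k * L ^ (p + 2)\<rceil>"
        have H1: "H \<ge> 1" and Hy: "real H \<le> y" "y \<le> 2 * real H"
        proof -
          have "real H = of_int \<lfloor>y\<rfloor>" "1 \<le> \<lfloor>y\<rfloor>" using True by (simp_all add: H_def)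
          then show "H \<ge> 1" "real H \<le> y" "y \<le> 2 * real H" by linarith+
        qed
        have yX: "y * X = \<epsilon> * L" using X1 by (simp add: y_def)
        have XL: "X \<le> \<epsilon> * L" using True X1 yX mult_right_mono[of 1 y X] by simp
        have yL: "y \<le> L"
        proof -
          have "y * 1 \<le> y * X" using X1 True by (intro mult_left_mono) auto
          also have "\<dots> \<le> 1 * L" unfolding yX using \<epsilon> L by (intro mult_right_mono) auto
          finally show ?thesis by simp
        qed
        have "\<epsilon> * L \<le> L / 4" using \<epsilon> L mult_right_mono[of \<epsilon> "1/4" L] by simp
        then have lnkL: "ln (real k) \<le> L / 4" using XL lnL by (simp add: X_def)
        have kL: "2 \<le> real k * L ^ (p + 2)"
        proof -
          have "2 \<le> L ^ (p + 2)" using self_le_power[of L "p + 2"] L by linarith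
          then show ?thesis using mult_mono[of 1 "real k" 2 "L ^ (p + 2)"] k L by simp
        qed
        have Dge: "real k * L ^ (p + 2) \<le> real D" unfolding D_def using kL by linarith
        then have D2: "D \<ge> 2" using kL by linarith
        \<comment> \<open>Rounding up costs at most one further factor \<open>L\<close>, hence the
          \<open>p + 3\<close> in \<open>\<epsilon>\<close>.\<close>
        have "real D \<le> real k * L ^ (p + 2) + 1" unfolding D_def using kL by linarith
        also have "\<dots> \<le> real k * L ^ (p + 2) * 2" using kL by linarith
        also have "\<dots> \<le> real k * L ^ (p + 2) * L" using L kL by (intro mult_left_mono) auto
        also have "\<dots> = real k * L ^ (p + 3)" by (simp add: eval_nat_numeral)
        finally have "ln (real D) \<le> ln (real k * L ^ (p + 3))" using D2 by simp
        also have "\<dots> = ln (real k) + (real p + 3) * ln L"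
          using k L by (simp add: ln_mult ln_realpow)
        also have "\<dots> \<le> (real p + 3) * ln (real k) + (real p + 3) * ln L"
          using lnk mult_right_mono[of 1 "real p + 3" "ln (real k)"] by simp
        finally have lnD: "ln (real D) \<le> (real p + 3) * X" by (simp add: X_def algebra_simps)
        define T where "T = C * (real n * real k) * (2 * L) ^ p"
        have T: "real (running_time d (A n k)) \<le> T" if "Metric_space {..<n} d" for d
        proof -
          have nk: "1 \<le> real n * real k"
            using mult_mono[of 1 "real n" 1 "real k"] n1 k by simp
          have "real (running_time d (A n k)) \<le> C0 * (real n * real k) * ln (real n * real k) ^ p"
            using elim(1) k that by blast
          also have "\<dots> \<le> C * (real n * real k) * ln (real n * real k) ^ p"
            using nk by (intro mult_right_mono) (auto simp: C_def)
          also have "\<dots> \<le> T" unfolding T_def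
          proof (intro mult_left_mono power_mono)
            have "ln (real n * real k) = L + ln (real k)" using n1 k by (simp add: ln_mult L_def)
            then show "ln (real n * real k) \<le> 2 * L" using lnkL L by linarith
          qed (use nk in \<open>auto simp: C_def\<close>)
          finally show ?thesis .
        qed
        have TH: "4 * T * real H \<le> real D * real n"
        proof -
          have "4 * T * real H \<le> 4 * T * L"
            using Hy yL L by (intro mult_left_mono) (auto simp: T_def C_def)
          also have "\<dots> = (4 * C * 2 ^ p) * (L ^ (p + 1) * (real n * real k))"
            by (simp add: T_def power_mult_distrib)
          also have "\<dots> \<le> L * (L ^ (p + 1) * (real n * real k))"
            using L by (intro mult_right_mono) auto
          also have "\<dots> = (real k * L ^ (p + 2)) * real n" by simp
          also have "\<dots> \<le> real D * real n" using Dge by (intro mult_right_mono) auto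
          finally show ?thesis .
        qed
        have kD: "4 * H * k * D ^ H \<le> n"
        proof -
          have pos: "0 < real H" "0 < real k" "0 < real D" using H1 k D2 by auto
          \<comment> \<open>The budget \<open>L\<close> is split into \<open>L / 2\<close> for
            \<open>4 * H\<close>, \<open>L / 4\<close> for \<open>k\<close> and \<open>L / 4\<close>
            for \<open>D ^ H\<close>.\<close>
          have "ln (4 * real H * real k * real D ^ H)
              = ln 4 + ln (real H) + ln (real k) + real H * ln (real D)"
            using pos by (simp add: ln_mult ln_realpow)
          also have "\<dots> \<le> ln 4 + ln L + L / 4 + y * ((real p + 3) * X)"
          proof (intro add_mono mult_mono)
            show "ln (real H) \<le> ln L" using Hy yL pos by simp
          qed (use lnkL Hy lnD True D2 in auto)
          also have "y * ((real p + 3) * X) = (real p + 3) * (y * X)" by simp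
          also have "\<dots> = (\<epsilon> * (real p + 3)) * L" unfolding yX by simp
          also have "\<dots> = L / 4" unfolding \<epsilon>(3) by simp
          also have "ln 4 + ln L + L / 4 + L / 4 \<le> L" using lnL_small by simp
          finally have "ln (4 * real H * real k * real D ^ H) \<le> ln (real n)" by (simp add: L_def)
          then have "4 * real H * real k * real D ^ H \<le> real n" using pos n1 by simp
          then have "real (4 * H * k * D ^ H) \<le> real n" by simp
          then show ?thesis by (simp only: of_nat_le_iff)
        qed
        \<comment> \<open>The 8 is the 4 of \<open>approx_ratio_ge\<close> times the 2 lost in
          rounding \<open>y\<close> down to \<open>H\<close>.\<close>
        have "ereal (y / 8) \<le> ereal (real H / 4)" using Hy by simp
        also have "\<dots> \<le> approx_ratio A n k"
          by (rule approx_ratio_ge[OF assms(1) n1 k T D2 H1 TH kD])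
        finally show "ereal (y / 8) \<le> approx_ratio A n k" .
      qed
    qed
  qed
  then show ?thesis using \<epsilon>(1) by (intro exI[of _ "\<epsilon> / 8"]) simp
qed

end
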